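(* Let $n_1, n_2$ be nonnegative integers and let $p:\mathbb{R}^2\to\mathbb{R}$ be a polynomial of the form $$p(x_1,x_2)=\sum_{i=0}^{n_1}\sum_{j=0}^{n_2} a_{i,j}\,x_1^i x_2^j,\qquad a_{i,j}\in\mathbb{R},$$ such that $p(x_1,x_2)>0$ for every $(x_1,x_2)\in[0,1]\times[0,1]$. Then there exist integers $q_1\ge n_1$, $q_2\ge n_2$ and real numbers $C_{i,j}>0$, for all $(i,j)\in\{0,1,\ldots,q_1\}\times\{0,1,\ldots,q_2\}$, such that $$p(x_1,x_2)=\sum_{i=0}^{q_1}\sum_{j=0}^{q_2} C_{i,j}\,x_1^{i}(1-x_1)^{q_1-i}x_2^{j}(1-x_2)^{q_2-j}$$ for all $(x_1,x_2)\in\mathbb{R}^2$. *)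

theory Defs
  imports "HOL-Analysis.Analysis"
begin

end

theory Submission
  imports Defs
begin

text \<open>
  Expanding \<open>x ^ i = x ^ i * (x + (1 - x)) ^ (q - i)\<close> rewrites \<open>p\<close> in the Bernstein basis of
  degree \<open>(q, q)\<close>. After division by the binomial coefficients, the coefficient with index
  \<open>(k, l)\<close> differs from \<open>p (k / q, l / q)\<close> by \<open>O (1 / q)\<close> uniformly in \<open>k\<close> and \<open>l\<close>; as \<open>p\<close> has a
  positive minimum on the square, all coefficients are positive for large \<open>q\<close>.
\<close>

text \<open>For \<open>i \<le> k \<le> q\<close> this is the quotient of falling factorials
  \<open>k (k - 1) ... (k - i + 1)\<close> over \<open>q (q - 1) ... (q - i + 1)\<close>, which
  resembles \<open>(k / q) ^ i\<close>. The explicit value 0 matters: for \<open>k < i\<close>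
  truncated subtraction would turn the binomial into \<open>(q - i) choose 0 = 1\<close>.\<close>

definition bernstein_ratio :: "nat \<Rightarrow> nat \<Rightarrow> nat \<Rightarrow> real" where
  "bernstein_ratio i q k =
     (if i \<le> k then real ((q - i) choose (k - i)) / real (q choose k) else 0)"

lemma power_eq_bernstein_sum:
  fixes x :: real
  assumes "i \<le> q"
  shows "x ^ i = (\<Sum>k=0..q. real (q choose k) * bernstein_ratio i q k * (x ^ k * (1 - x) ^ (q - k)))"
proof -
  have "x ^ i = x ^ i * (x + (1 - x)) ^ (q - i)"
    by simp
  also have "\<dots> = (\<Sum>k\<le>q - i. real ((q - i) choose k) * (x ^ (k + i) * (1 - x) ^ (q - (k + i))))"
    unfolding binomial_ring sum_distrib_left
    by (intro sum.cong refl) (simp add: power_add mult_ac diff_diff_left add.commute)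
  also have "\<dots> = (\<Sum>k\<in>{i..q}. real ((q - i) choose (k - i)) * (x ^ k * (1 - x) ^ (q - k)))"
    using assms by (intro sum.reindex_bij_witness[of _ "\<lambda>k. k - i" "\<lambda>k. k + i"]) auto
  also have "\<dots> = (\<Sum>k\<in>{i..q}. real (q choose k) * bernstein_ratio i q k * (x ^ k * (1 - x) ^ (q - k)))"
    by (intro sum.cong refl) (simp add: bernstein_ratio_def)
  \<comment> \<open>The added indices \<open>k < i\<close> contribute nothing, by the default value
    0.\<close>
  also have "\<dots> = (\<Sum>k=0..q. real (q choose k) * bernstein_ratio i q k * (x ^ k * (1 - x) ^ (q - k)))"
    by (intro sum.mono_neutral_left) (auto simp: bernstein_ratio_def)
  finally show ?thesis .
qed

lemma bernstein_ratio_0 [simp]: "k \<le> q \<Longrightarrow> bernstein_ratio 0 q k = 1"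
  by (simp add: bernstein_ratio_def)

text \<open>Peels one factor off the falling factorials. It drives the inductions on
  \<open>i\<close> below and comes from the absorption identity for binomials.\<close>

lemma bernstein_ratio_Suc:
  assumes "k \<le> q" "i < q"
  shows "bernstein_ratio (Suc i) q k = bernstein_ratio i q k * ((real k - real i) / (real q - real i))"
proof (cases "i < k")
  case True
  then obtain m where m: "k = i + Suc m"
    using less_imp_Suc_add by fastforce
  from assms obtain r where r: "q = i + Suc r"
    using less_imp_Suc_add by fastforce
  have "Suc r * (r choose m) = (Suc r choose Suc m) * Suc m"
    by (rule Suc_times_binomial_eq)
  then have "real (Suc r) * real (r choose m) = real (Suc r choose Suc m) * real (Suc m)"
    by (metis of_nat_mult)
  then have "real (r choose m) = real (Suc r choose Suc m) * (real (Suc m) / real (Suc r))"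
    by (simp add: field_simps del: binomial_Suc_Suc)
  then show ?thesis
    using True by (simp add: bernstein_ratio_def m r del: binomial_Suc_Suc)
\<comment> \<open>Here the left side is 0. On the right, \<open>k - i\<close> vanishes if
  \<open>i = k\<close>, and the ratio itself vanishes if \<open>i > k\<close>.\<close>
next
  case False
  then show ?thesis
    by (simp add: bernstein_ratio_def)
qed

lemma bernstein_ratio_bounds:
  assumes "k \<le> q" "i \<le> q"
  shows "0 \<le> bernstein_ratio i q k" "bernstein_ratio i q k \<le> 1"
proof -
  show nonneg: "0 \<le> bernstein_ratio i q k" for i
    by (simp add: bernstein_ratio_def)
  show "bernstein_ratio i q k \<le> 1"
    using \<open>i \<le> q\<close>
  proof (induction i)
    case 0
    then show ?case using assms by simp
  next
    case (Suc i)
    show ?case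
    proof (cases "i < k")
      case True
      have "bernstein_ratio i q k * ((real k - real i) / (real q - real i)) \<le> 1 * 1"
        using Suc nonneg True assms by (intro mult_mono) (auto simp: divide_le_eq_1)
      then show ?thesis
        using Suc assms by (simp add: bernstein_ratio_Suc)
    qed (simp add: bernstein_ratio_def)
  qed
qed

text \<open>Induction on \<open>i\<close> with the splitting
  \<open>r * s - t ^ Suc i = r * (s - t) + (r - t ^ i) * t\<close>. The first term adds an error of
  at most \<open>i / q\<close>, and \<open>i * i + i \<le> Suc i * Suc i\<close> closes the
  step.\<close>

lemma bernstein_ratio_approx:
  assumes "k \<le> q" "i \<le> q"
  shows "\<bar>bernstein_ratio i q k - (real k / real q) ^ i\<bar> \<le> real (i * i) / real q"
  using \<open>i \<le> q\<close>
proof (induction i)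
  case 0
  then show ?case using assms by simp
next
  case (Suc i)
  define r where "r = bernstein_ratio i q k"
  define s where "s = (real k - real i) / (real q - real i)"
  define t where "t = real k / real q"
  have t: "0 \<le> t" "t \<le> 1"
    using assms by (auto simp: t_def divide_le_eq_1)
  have r: "0 \<le> r" "r \<le> 1"
    using bernstein_ratio_bounds[of k q i] assms Suc by (auto simp: r_def)
  \<comment> \<open>The factor \<open>r\<close> must stay: for \<open>k < i\<close> the difference
    \<open>s - t\<close> alone can be large, but then \<open>r = 0\<close>.\<close>
  have "\<bar>r * (s - t)\<bar> \<le> real i / real q"
  proof (cases "i \<le> k")
    case True
    have "t - s = real i / real q * ((real q - real k) / (real q - real i))"
      using Suc.prems by (simp add: s_def t_def field_simps)
    moreover have "0 \<le> (real q - real k) / (real q - real i)"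
      "(real q - real k) / (real q - real i) \<le> 1"
      using True assms Suc.prems by (auto simp: divide_le_eq_1)
    ultimately have "0 \<le> t - s" "t - s \<le> real i / real q"
      by (simp_all only: mult_left_le mult_nonneg_nonneg divide_nonneg_nonneg of_nat_0_le_iff)
    then show ?thesis
      using r mult_mono[of r 1 "t - s" "real i / real q"] by (simp add: abs_mult)
  next
    case False
    then show ?thesis by (simp add: r_def bernstein_ratio_def)
  qed
  moreover have "\<bar>(r - t ^ i) * t\<bar> \<le> real (i * i) / real q"
  proof -
    have "\<bar>(r - t ^ i) * t\<bar> \<le> \<bar>r - t ^ i\<bar>"
      using t by (simp add: abs_mult mult_left_le)
    also have "\<dots> \<le> real (i * i) / real q"
      using Suc by (simp add: r_def t_def)
    finally show ?thesis .
  qed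
  ultimately have "\<bar>r * s - t ^ Suc i\<bar> \<le> real i / real q + real (i * i) / real q"
    by (simp add: algebra_simps)
  also have "\<dots> \<le> real (Suc i * Suc i) / real q"
    by (simp add: add_divide_distrib[symmetric] divide_right_mono algebra_simps)
  finally show ?case
    using assms Suc.prems by (simp add: bernstein_ratio_Suc r_def s_def t_def)
qed

text \<open>Changing one factor at a time adds the two one-variable errors, since all factors lie in
  \<open>[0, 1]\<close>. The bound is free of \<open>i\<close>, \<open>j\<close>, \<open>k\<close>,
  \<open>l\<close>, so it can be pulled out of the sum over the monomials.\<close>

lemma bernstein_ratio_mult_approx:
  assumes "k \<le> q" "l \<le> q" "i \<le> n\<^sub>1" "j \<le> n\<^sub>2" "n\<^sub>1 \<le> q" "n\<^sub>2 \<le> q"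
  shows "\<bar>bernstein_ratio i q k * bernstein_ratio j q l - (real k / real q) ^ i * (real l / real q) ^ j\<bar>
    \<le> real (n\<^sub>1 * n\<^sub>1 + n\<^sub>2 * n\<^sub>2) / real q"
proof -
  let ?r = "bernstein_ratio i q k" and ?s = "bernstein_ratio j q l"
  let ?x = "(real k / real q) ^ i" and ?y = "(real l / real q) ^ j"
  have s: "0 \<le> ?s" "?s \<le> 1"
    using bernstein_ratio_bounds[of l q j] assms by auto
  have x: "0 \<le> ?x" "?x \<le> 1"
    using assms by (auto intro!: power_le_one simp: divide_le_eq_1)
  have "\<bar>?r * ?s - ?x * ?y\<bar> = \<bar>(?r - ?x) * ?s + ?x * (?s - ?y)\<bar>"
    by (simp add: algebra_simps)
  also have "\<dots> \<le> \<bar>?r - ?x\<bar> * \<bar>?s\<bar> + \<bar>?x\<bar> * \<bar>?s - ?y\<bar>"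
    unfolding abs_mult[symmetric] by (rule abs_triangle_ineq)
  also have "\<dots> \<le> \<bar>?r - ?x\<bar> + \<bar>?s - ?y\<bar>"
    using s x by (intro add_mono) (auto intro: mult_left_le mult_left_le_one_le)
  also have "\<dots> \<le> real (i * i) / real q + real (j * j) / real q"
    using assms by (intro add_mono bernstein_ratio_approx) auto
  also have "\<dots> \<le> real (n\<^sub>1 * n\<^sub>1 + n\<^sub>2 * n\<^sub>2) / real q"
    unfolding add_divide_distrib[symmetric] of_nat_add[symmetric]
    using assms by (intro divide_right_mono of_nat_mono add_mono mult_mono) auto
  finally show ?thesis .
qed

theorem theorem1:
  fixes n\<^sub>1 n\<^sub>2 :: nat
    and a :: "nat \<Rightarrow> nat \<Rightarrow> real"
    and p :: "real \<times> real \<Rightarrow> real"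
  assumes p_poly: "\<And>x\<^sub>1 x\<^sub>2. p (x\<^sub>1, x\<^sub>2) = (\<Sum>i=0..n\<^sub>1. \<Sum>j=0..n\<^sub>2. a i j * x\<^sub>1 ^ i * x\<^sub>2 ^ j)"
    and p_pos: "\<And>x\<^sub>1 x\<^sub>2. (x\<^sub>1, x\<^sub>2) \<in> {0..1} \<times> {0..1} \<Longrightarrow> p (x\<^sub>1, x\<^sub>2) > 0"
  shows "\<exists>(q\<^sub>1::nat) (q\<^sub>2::nat) (C :: nat \<Rightarrow> nat \<Rightarrow> real).
           q\<^sub>1 \<ge> n\<^sub>1 \<and> q\<^sub>2 \<ge> n\<^sub>2 \<and>
           (\<forall>i\<in>{0..q\<^sub>1}. \<forall>j\<in>{0..q\<^sub>2}. C i j > 0) \<and>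
           (\<forall>x\<^sub>1 x\<^sub>2. p (x\<^sub>1, x\<^sub>2) =
              (\<Sum>i=0..q\<^sub>1. \<Sum>j=0..q\<^sub>2.
                 C i j * x\<^sub>1 ^ i * (1 - x\<^sub>1) ^ (q\<^sub>1 - i) * x\<^sub>2 ^ j * (1 - x\<^sub>2) ^ (q\<^sub>2 - j)))"
proof -
  have p_eq: "p = (\<lambda>z. \<Sum>i=0..n\<^sub>1. \<Sum>j=0..n\<^sub>2. a i j * fst z ^ i * snd z ^ j)"
    using p_poly by (auto simp: fun_eq_iff)
  have "continuous_on ({0..1} \<times> {0..1}) p"
    unfolding p_eq by (intro continuous_intros)
  moreover have "compact ({0..1::real} \<times> {0..1::real})"
    by (intro compact_Times) auto
  ultimately obtain z where z: "z \<in> {0..1} \<times> {0..1}"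
    and z_min: "\<And>w. w \<in> {0..1} \<times> {0..1} \<Longrightarrow> p z \<le> p w"
    using continuous_attains_inf[of "{0..1::real} \<times> {0..1::real}" p] by fastforce
  define A where "A = (\<Sum>i=0..n\<^sub>1. \<Sum>j=0..n\<^sub>2. \<bar>a i j\<bar>)"
  define B where "B = real (n\<^sub>1 * n\<^sub>1 + n\<^sub>2 * n\<^sub>2)"
  have "p z > 0"
    using z p_pos by (cases z) auto
  obtain N :: nat where N: "A * B / p z < real N"
    using reals_Archimedean2 by blast
  \<comment> \<open>A single degree serves both variables. \<open>Suc N\<close> makes
    \<open>q\<close> positive at once, and the bound by \<open>N\<close> pushes the total error
    \<open>A * (B / q)\<close> below the minimum \<open>p z\<close>.\<close>
  define q where "q = max (Suc N) (max n\<^sub>1 n\<^sub>2)"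
  have q: "q > 0" "n\<^sub>1 \<le> q" "n\<^sub>2 \<le> q" "real N \<le> real q"
    by (auto simp: q_def)
  have "A * B < real N * p z"
    using N \<open>p z > 0\<close> by (simp add: field_simps)
  also have "\<dots> \<le> real q * p z"
    using q(4) \<open>p z > 0\<close> by (intro mult_right_mono) auto
  finally have small: "A * (B / real q) < p z"
    using q(1) by (simp add: field_simps)
  \<comment> \<open>The Bernstein coefficients without their binomial factors: only in this
    normalisation are they close to values of \<open>p\<close>.\<close>
  define c where "c k l = (\<Sum>i=0..n\<^sub>1. \<Sum>j=0..n\<^sub>2. a i j * (bernstein_ratio i q k * bernstein_ratio j q l))" for k l
  have c_pos: "c k l > 0" if "k \<le> q" "l \<le> q" for k l
  proof -
    let ?x = "real k / real q" and ?y = "real l / real q"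
    have "\<bar>c k l - p (?x, ?y)\<bar> = \<bar>\<Sum>i=0..n\<^sub>1. \<Sum>j=0..n\<^sub>2.
        a i j * (bernstein_ratio i q k * bernstein_ratio j q l - ?x ^ i * ?y ^ j)\<bar>"
      unfolding c_def p_poly by (simp only: sum_subtractf[symmetric] right_diff_distrib mult.assoc)
    also have "\<dots> \<le> (\<Sum>i=0..n\<^sub>1. \<bar>\<Sum>j=0..n\<^sub>2.
        a i j * (bernstein_ratio i q k * bernstein_ratio j q l - ?x ^ i * ?y ^ j)\<bar>)"
      by (rule sum_abs)
    also have "\<dots> \<le> (\<Sum>i=0..n\<^sub>1. \<Sum>j=0..n\<^sub>2. \<bar>a i j\<bar> * (B / real q))"
    proof (rule sum_mono)
      fix i assume "i \<in> {0..n\<^sub>1}"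
      then show "\<bar>\<Sum>j=0..n\<^sub>2. a i j * (bernstein_ratio i q k * bernstein_ratio j q l - ?x ^ i * ?y ^ j)\<bar>
          \<le> (\<Sum>j=0..n\<^sub>2. \<bar>a i j\<bar> * (B / real q))"
        unfolding B_def using that q
        by (intro order.trans[OF sum_abs] sum_mono)
          (auto simp only: abs_mult atLeastAtMost_iff intro!: mult_left_mono bernstein_ratio_mult_approx)
    qed
    also have "\<dots> = A * (B / real q)"
      by (simp only: A_def sum_distrib_right)
    finally have "\<bar>c k l - p (?x, ?y)\<bar> < p z"
      using small by simp
    \<comment> \<open>The grid point lies in the square, so the value there is at least
      \<open>p z\<close>, while \<open>c k l\<close> deviates from it by less than
      \<open>p z\<close>.\<close>
    moreover have "p z \<le> p (?x, ?y)"
      using that q by (intro z_min) (auto simp: divide_le_eq_1)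
    ultimately show ?thesis
      by linarith
  qed
  have expand: "p (x\<^sub>1, x\<^sub>2) = (\<Sum>k=0..q. \<Sum>l=0..q. real (q choose k) * real (q choose l) * c k l
      * x\<^sub>1 ^ k * (1 - x\<^sub>1) ^ (q - k) * x\<^sub>2 ^ l * (1 - x\<^sub>2) ^ (q - l))" for x\<^sub>1 x\<^sub>2
  proof -
    define b where "b x k = real (q choose k) * (x ^ k * (1 - x) ^ (q - k))" for x :: real and k
    have b: "x ^ i = (\<Sum>k=0..q. bernstein_ratio i q k * b x k)" if "i \<le> q" for x i
      using power_eq_bernstein_sum[OF that, of x] by (simp add: b_def mult_ac)
    have "p (x\<^sub>1, x\<^sub>2) = (\<Sum>i=0..n\<^sub>1. \<Sum>j=0..n\<^sub>2. \<Sum>k=0..q. \<Sum>l=0..q.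
        a i j * (bernstein_ratio i q k * bernstein_ratio j q l) * (b x\<^sub>1 k * b x\<^sub>2 l))"
      unfolding p_poly
    proof (intro sum.cong refl)
      fix i j assume "i \<in> {0..n\<^sub>1}" "j \<in> {0..n\<^sub>2}"
      then have "i \<le> q" "j \<le> q"
        using q by auto
      then show "a i j * x\<^sub>1 ^ i * x\<^sub>2 ^ j = (\<Sum>k=0..q. \<Sum>l=0..q.
          a i j * (bernstein_ratio i q k * bernstein_ratio j q l) * (b x\<^sub>1 k * b x\<^sub>2 l))"
        by (simp only: b[of i x\<^sub>1] b[of j x\<^sub>2] mult.assoc sum_product)
          (simp add: sum_distrib_left mult_ac)
    qed
    \<comment> \<open>Four exchanges of adjacent sums move the order \<open>i, j, k, l\<close> to
      \<open>k, l, i, j\<close>, so that the inner double sum becomes \<open>c k l\<close>.\<close>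
    also have "\<dots> = (\<Sum>i=0..n\<^sub>1. \<Sum>k=0..q. \<Sum>j=0..n\<^sub>2. \<Sum>l=0..q.
        a i j * (bernstein_ratio i q k * bernstein_ratio j q l) * (b x\<^sub>1 k * b x\<^sub>2 l))"
      by (rule sum.cong[OF refl], rule sum.swap)
    also have "\<dots> = (\<Sum>k=0..q. \<Sum>i=0..n\<^sub>1. \<Sum>j=0..n\<^sub>2. \<Sum>l=0..q.
        a i j * (bernstein_ratio i q k * bernstein_ratio j q l) * (b x\<^sub>1 k * b x\<^sub>2 l))"
      by (rule sum.swap)
    also have "\<dots> = (\<Sum>k=0..q. \<Sum>i=0..n\<^sub>1. \<Sum>l=0..q. \<Sum>j=0..n\<^sub>2.
        a i j * (bernstein_ratio i q k * bernstein_ratio j q l) * (b x\<^sub>1 k * b x\<^sub>2 l))"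
      by (rule sum.cong[OF refl], rule sum.cong[OF refl], rule sum.swap)
    also have "\<dots> = (\<Sum>k=0..q. \<Sum>l=0..q. \<Sum>i=0..n\<^sub>1. \<Sum>j=0..n\<^sub>2.
        a i j * (bernstein_ratio i q k * bernstein_ratio j q l) * (b x\<^sub>1 k * b x\<^sub>2 l))"
      by (rule sum.cong[OF refl], rule sum.swap)
    also have "\<dots> = (\<Sum>k=0..q. \<Sum>l=0..q. c k l * (b x\<^sub>1 k * b x\<^sub>2 l))"
      by (simp only: c_def sum_distrib_right)
    also have "\<dots> = (\<Sum>k=0..q. \<Sum>l=0..q. real (q choose k) * real (q choose l) * c k l
        * x\<^sub>1 ^ k * (1 - x\<^sub>1) ^ (q - k) * x\<^sub>2 ^ l * (1 - x\<^sub>2) ^ (q - l))"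
      by (simp add: b_def mult_ac)
    finally show ?thesis .
  qed
  \<comment> \<open>Restoring the binomials keeps the sign, as they are positive for
    \<open>k, l \<le> q\<close>.\<close>
  have "\<forall>k\<in>{0..q}. \<forall>l\<in>{0..q}. real (q choose k) * real (q choose l) * c k l > 0"
    using c_pos by simp
  with q expand show ?thesis
    by (intro exI[where x=q] exI[where x="\<lambda>k l. real (q choose k) * real (q choose l) * c k l"]) blast
qed

end
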